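(* (1) If $\varphi$ is valid over the class of epistemic frames, then $\vdash_{\mathrm{ICK}}\varphi$. (2) If $\varphi$ is valid over the class of reflexive frames, then $\vdash_{\mathrm{ICKT}}\varphi$. (3) If $\varphi$ is valid over the class of S4 frames, then $\vdash_{\mathrm{ICKS4}}\varphi$. (4) If $\varphi$ is valid over the class of S5 frames, then $\vdash_{\mathrm{ICKS5}}\varphi$.
   Context: Formulae over a finite non-empty set $\mathsf{A}$ of agents and atoms $\mathrm{Prop}$: $\varphi ::= \bot \mid p \mid \varphi\wedge\varphi\mid\varphi\vee\varphi\mid\varphi\to\varphi\mid K_a\varphi\mid C\varphi$; $\neg\varphi:=\varphi\to\bot$, $E\varphi:=\bigwedge_aK_a\varphi$. Hilbert systems: axiom schemes Int (uniform substitution instances of intuitionistic propositional tautologies), $\mathsf{K}_a$: $K_a(\varphi\to\psi)\to(K_a\varphi\to K_a\psi)$, $\mathsf{K}^c_a$: $(K_a\varphi\to\psi)\to(\neg K_a\varphi\vee\psi)$, $\mathsf{T}_a$: $K_a\varphi\to\varphi$, $\mathsf{S4}_a$: $K_a\varphi\to K_aK_a\varphi$, $\mathsf{S5}_a$: $\neg K_a\varphi\to K_a\neg K_a\varphi$, Fix: $C\varphi\leftrightarrow(\varphi\wedge EC\varphi)$; rules MP, $\mathsf{Nec}_a$ (from $\varphi$ infer $K_a\varphi$), Mon (from $\varphi\to\psi$ infer $C\varphi\to C\psi$), Ind (from $\varphi\to E\varphi$ infer $\varphi\to C\varphi$). $\mathrm{ICK}$: Int, $\mathsf{K}_a$, Fix,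 all rules; $\mathrm{ICKT}$ adds $\mathsf{T}_a$; $\mathrm{ICKS4}$ further adds $\mathsf{S4}_a$; $\mathrm{ICKS5}$ further adds $\mathsf{K}^c_a,\mathsf{S5}_a$. $\vdash_{\mathrm{P}}\varphi$: $\varphi$ has a finite derivation from axioms via the rules. Semantics: an epistemic frame $(\mathcal{W},\leq,\{R_a\})$ has $\mathcal{W}\neq\emptyset$, $\leq$ a partial order, $R_a\subseteq\mathcal{W}^2$ with triangle confluence ($w\leq v$, $vR_au$ imply $wR_au$); reflexive/S4/S5 frames have every $R_a$ reflexive / reflexive and transitive / an equivalence relation. Models add a $\leq$-monotone valuation; $w\models\varphi\to\psi$ iff for all $v\geq w$, $v\models\varphi$ implies $v\models\psi$; $w\models K_a\varphi$ iff all $R_a$-successors satisfy $\varphi$; $w\models C\varphi$ iff all $R^*$-successors satisfy $\varphi$ ($R^*$ reflexive–transitive closure of $\bigcup_aR_a$); atoms, $\bot,\wedge,\vee$ as usual. Valid over a class = true at every world of every model on a frame of the class. *)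

theory Defs
  imports Main
begin

section \<open>Formulae\<close>

text \<open>Agents are the elements of a finite (hence non-empty) type \<open>'a\<close>, atoms those of an
  arbitrary type \<open>'p\<close>.\<close>

datatype ('a, 'p) fm =
    Bot
  | Atom 'p
  | And "('a, 'p) fm" "('a, 'p) fm"
  | Or "('a, 'p) fm" "('a, 'p) fm"
  | Imp "('a, 'p) fm" "('a, 'p) fm"
  | Know 'a "('a, 'p) fm"
  | Common "('a, 'p) fm"

abbreviation Neg :: "('a, 'p) fm \<Rightarrow> ('a, 'p) fm" where
  "Neg \<phi> \<equiv> Imp \<phi> Bot"

abbreviation Iff :: "('a, 'p) fm \<Rightarrow> ('a, 'p) fm \<Rightarrow> ('a, 'p) fm" where
  "Iff \<phi> \<psi> \<equiv> And (Imp \<phi> \<psi>) (Imp \<psi> \<phi>)"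

text \<open>Writing \<open>E \<phi>\<close> as a formula requires an order on the conjuncts \<open>K\<^sub>a \<phi>\<close>; one enumeration
  of the agents is chosen once and for all. It is never the empty list, so the first equation
  of \<open>Conj\<close> plays no role.\<close>

definition agents :: "'a::finite list" where
  "agents = (SOME as. distinct as \<and> set as = UNIV)"

fun Conj :: "('a, 'p) fm list \<Rightarrow> ('a, 'p) fm" where
  "Conj [] = Neg Bot"
| "Conj [\<phi>] = \<phi>"
| "Conj (\<phi> # \<psi> # \<phi>s) = And \<phi> (Conj (\<psi> # \<phi>s))"

definition Everyone :: "('a::finite, 'p) fm \<Rightarrow> ('a, 'p) fm" where
  "Everyone \<phi> = Conj (map (\<lambda>a. Know a \<phi>) agents)"

section \<open>Intuitionistic propositional logic\<close>

text \<open>Intuitionistic tautologies are the theorems of the usual Hilbert calculus for IPC. The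
  propositional variables are the natural numbers, independently of \<open>'p\<close>, so that there are
  enough schematic letters even if \<open>'p\<close> is finite.\<close>

datatype pfm =
    PBot
  | PVar nat
  | PAnd pfm pfm
  | POr pfm pfm
  | PImp pfm pfm

inductive ipc :: "pfm \<Rightarrow> bool" where
  ipc_K: "ipc (PImp A (PImp B A))"
| ipc_S: "ipc (PImp (PImp A (PImp B D)) (PImp (PImp A B) (PImp A D)))"
| ipc_andI: "ipc (PImp A (PImp B (PAnd A B)))"
| ipc_andE1: "ipc (PImp (PAnd A B) A)"
| ipc_andE2: "ipc (PImp (PAnd A B) B)"
| ipc_orI1: "ipc (PImp A (POr A B))"
| ipc_orI2: "ipc (PImp B (POr A B))"
| ipc_orE: "ipc (PImp (PImp A D) (PImp (PImp B D) (PImp (POr A B) D)))"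
| ipc_botE: "ipc (PImp PBot A)"
| ipc_MP: "ipc (PImp A B) \<Longrightarrow> ipc A \<Longrightarrow> ipc B"

primrec psubst :: "(nat \<Rightarrow> ('a, 'p) fm) \<Rightarrow> pfm \<Rightarrow> ('a, 'p) fm" where
  "psubst \<sigma> PBot = Bot"
| "psubst \<sigma> (PVar n) = \<sigma> n"
| "psubst \<sigma> (PAnd A B) = And (psubst \<sigma> A) (psubst \<sigma> B)"
| "psubst \<sigma> (POr A B) = Or (psubst \<sigma> A) (psubst \<sigma> B)"
| "psubst \<sigma> (PImp A B) = Imp (psubst \<sigma> A) (psubst \<sigma> B)"

section \<open>Hilbert systems\<close>

definition ax_Int :: "('a, 'p) fm set" where
  "ax_Int = {psubst \<sigma> A |\<sigma> A. ipc A}"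

definition ax_K :: "('a, 'p) fm set" where
  "ax_K = {Imp (Know a (Imp \<phi> \<psi>)) (Imp (Know a \<phi>) (Know a \<psi>)) |a \<phi> \<psi>. True}"

definition ax_Kc :: "('a, 'p) fm set" where
  "ax_Kc = {Imp (Imp (Know a \<phi>) \<psi>) (Or (Neg (Know a \<phi>)) \<psi>) |a \<phi> \<psi>. True}"

definition ax_T :: "('a, 'p) fm set" where
  "ax_T = {Imp (Know a \<phi>) \<phi> |a \<phi>. True}"

definition ax_S4 :: "('a, 'p) fm set" where
  "ax_S4 = {Imp (Know a \<phi>) (Know a (Know a \<phi>)) |a \<phi>. True}"

definition ax_S5 :: "('a, 'p) fm set" where
  "ax_S5 = {Imp (Neg (Know a \<phi>)) (Know a (Neg (Know a \<phi>))) |a \<phi>. True}"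

definition ax_Fix :: "('a::finite, 'p) fm set" where
  "ax_Fix = {Iff (Common \<phi>) (And \<phi> (Everyone (Common \<phi>))) |\<phi>. True}"

definition ICK :: "('a::finite, 'p) fm set" where
  "ICK = ax_Int \<union> ax_K \<union> ax_Fix"

definition ICKT :: "('a::finite, 'p) fm set" where
  "ICKT = ICK \<union> ax_T"

definition ICKS4 :: "('a::finite, 'p) fm set" where
  "ICKS4 = ICKT \<union> ax_S4"

definition ICKS5 :: "('a::finite, 'p) fm set" where
  "ICKS5 = ICKS4 \<union> ax_Kc \<union> ax_S5"

text \<open>A system is given by its set of axioms, the rules being the same for all four.\<close>

inductive derivable :: "('a::finite, 'p) fm set \<Rightarrow> ('a, 'p) fm \<Rightarrow> bool" (infix "\<turnstile>" 50)
  for P where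
  Ax: "\<phi> \<in> P \<Longrightarrow> P \<turnstile> \<phi>"
| MP: "P \<turnstile> Imp \<phi> \<psi> \<Longrightarrow> P \<turnstile> \<phi> \<Longrightarrow> P \<turnstile> \<psi>"
| Nec: "P \<turnstile> \<phi> \<Longrightarrow> P \<turnstile> Know a \<phi>"
| Mon: "P \<turnstile> Imp \<phi> \<psi> \<Longrightarrow> P \<turnstile> Imp (Common \<phi>) (Common \<psi>)"
| Ind: "P \<turnstile> Imp \<phi> (Everyone \<phi>) \<Longrightarrow> P \<turnstile> Imp \<phi> (Common \<phi>)"

section \<open>Semantics\<close>

record ('w, 'a) frame =
  worlds :: "'w set"
  le :: "'w rel"
  acc :: "'a \<Rightarrow> 'w rel"

definition epistemic_frame :: "('w, 'a) frame \<Rightarrow> bool" where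
  "epistemic_frame F \<longleftrightarrow>
     worlds F \<noteq> {} \<and>
     partial_order_on (worlds F) (le F) \<and>
     (\<forall>a. acc F a \<subseteq> worlds F \<times> worlds F) \<and>
     (\<forall>a w v u. (w, v) \<in> le F \<longrightarrow> (v, u) \<in> acc F a \<longrightarrow> (w, u) \<in> acc F a)"

definition epistemic_frames :: "('w, 'a) frame set" where
  "epistemic_frames = {F. epistemic_frame F}"

definition reflexive_frames :: "('w, 'a) frame set" where
  "reflexive_frames = {F. epistemic_frame F \<and> (\<forall>a. refl_on (worlds F) (acc F a))}"

definition S4_frames :: "('w, 'a) frame set" where
  "S4_frames =
     {F. epistemic_frame F \<and> (\<forall>a. refl_on (worlds F) (acc F a) \<and> trans (acc F a))}"

definition S5_frames :: "('w, 'a) frame set" where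
  "S5_frames = {F. epistemic_frame F \<and> (\<forall>a. equiv (worlds F) (acc F a))}"

text \<open>\<open>V w\<close> is the set of atoms true at \<open>w\<close>.\<close>

definition valuation :: "('w, 'a) frame \<Rightarrow> ('w \<Rightarrow> 'p set) \<Rightarrow> bool" where
  "valuation F V \<longleftrightarrow> (\<forall>w v. (w, v) \<in> le F \<longrightarrow> V w \<subseteq> V v)"

primrec sat :: "('w, 'a) frame \<Rightarrow> ('w \<Rightarrow> 'p set) \<Rightarrow> 'w \<Rightarrow> ('a, 'p) fm \<Rightarrow> bool" where
  "sat F V w Bot \<longleftrightarrow> False"
| "sat F V w (Atom p) \<longleftrightarrow> p \<in> V w"
| "sat F V w (And \<phi> \<psi>) \<longleftrightarrow> sat F V w \<phi> \<and> sat F V w \<psi>"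
| "sat F V w (Or \<phi> \<psi>) \<longleftrightarrow> sat F V w \<phi> \<or> sat F V w \<psi>"
| "sat F V w (Imp \<phi> \<psi>) \<longleftrightarrow> (\<forall>v. (w, v) \<in> le F \<longrightarrow> sat F V v \<phi> \<longrightarrow> sat F V v \<psi>)"
| "sat F V w (Know a \<phi>) \<longleftrightarrow> (\<forall>v. (w, v) \<in> acc F a \<longrightarrow> sat F V v \<phi>)"
| "sat F V w (Common \<phi>) \<longleftrightarrow> (\<forall>v. (w, v) \<in> (\<Union>a. acc F a)\<^sup>* \<longrightarrow> sat F V v \<phi>)"

text \<open>HOL cannot quantify over all types of worlds inside a formula, so validity is relative to
  the classes of frames whose worlds are drawn from a type \<open>'w\<close>. Used as a hypothesis, validity
  over the frames on one type \<open>'w\<close> is implied by validity over all frames; hence a completeness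
  statement for a given \<open>'w\<close> implies the one for all frames. For a finite \<open>'w\<close> it would be
  false, as the frames on \<open>'w\<close> would then have bounded size.\<close>

definition valid_over :: "('w, 'a) frame set \<Rightarrow> ('a, 'p) fm \<Rightarrow> bool" where
  "valid_over \<F> \<phi> \<longleftrightarrow>
     (\<forall>F\<in>\<F>. \<forall>V. valuation F V \<longrightarrow> (\<forall>w\<in>worlds F. sat F V w \<phi>))"

end

(* Fix a finite set of formulae that is closed under subformulae, contains K_a C psi along with
   C psi, and contains the negation of each of its formulae K_a psi. The prime theories inside this
   set are the worlds of a finite canonical model, ordered by inclusion. Accessibility compares the
   formulae K_a psi of two worlds, in a manner adapted to the system. If every world reachable from
   a given one contains psi, then the disjunction of the conjunctions of these worlds is a single
   formula chi that implies E chi, so rule Ind yields C psi. Being finite, the model can be copied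
   into any infinite type. *)
theory Submission
  imports Defs
begin

section \<open>Derivability from hypotheses\<close>

text \<open>Hypotheses are closed under modus ponens only: \<open>Nec\<close>, \<open>Mon\<close>
  and \<open>Ind\<close> enter through \<open>Thm\<close> and hence act on theorems alone. Otherwise
  the deduction theorem would fail.\<close>

inductive entails :: "('a::finite, 'p) fm set \<Rightarrow> ('a, 'p) fm set \<Rightarrow> ('a, 'p) fm \<Rightarrow> bool"
  for P \<Gamma> where
  Hyp: "\<phi> \<in> \<Gamma> \<Longrightarrow> entails P \<Gamma> \<phi>"
| Thm: "P \<turnstile> \<phi> \<Longrightarrow> entails P \<Gamma> \<phi>"
| MP: "entails P \<Gamma> (Imp \<phi> \<psi>) \<Longrightarrow> entails P \<Gamma> \<phi> \<Longrightarrow> entails P \<Gamma> \<psi>"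

fun Disj :: "('a, 'p) fm list \<Rightarrow> ('a, 'p) fm" where
  "Disj [] = Bot"
| "Disj (\<phi> # \<phi>s) = Or \<phi> (Disj \<phi>s)"

lemma ax_Int_psubst: "ipc A \<Longrightarrow> psubst \<sigma> A \<in> ax_Int"
  by (auto simp: ax_Int_def)

lemma set_agents: "set (agents :: 'a::finite list) = UNIV"
proof -
  have "\<exists>as :: 'a list. distinct as \<and> set as = UNIV"
    using finite_distinct_list[of "UNIV :: 'a set"] by auto
  then show ?thesis
    unfolding agents_def by (rule someI2_ex) simp
qed

text \<open>The lower bound \<open>ICK\<close> on the axioms is all that most of the argument uses,
  so it is carried out once for the four systems.\<close>

locale epistemic_logic =
  fixes P :: "('a::finite, 'p) fm set"
  assumes ICK_subset: "ICK \<subseteq> P"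
begin

abbreviation ent (infix "\<tturnstile>" 50) where
  "\<Gamma> \<tturnstile> \<phi> \<equiv> entails P \<Gamma> \<phi>"

section \<open>Intuitionistic rules and the deduction theorem\<close>

lemma Int: "ipc A \<Longrightarrow> \<Gamma> \<tturnstile> psubst \<sigma> A"
  using ICK_subset ax_Int_psubst[of A \<sigma>] by (auto simp: ICK_def intro!: Thm Ax)

lemma Int_K: "\<Gamma> \<tturnstile> Imp \<phi> (Imp \<psi> \<phi>)"
  \<comment> \<open>The substitution \<open>(!) [\<phi>, \<psi>]\<close> sends variable number i to
    the i-th entry of the list; only the listed indices occur in the axiom.\<close>
  using Int[OF ipc_K, of \<Gamma> "(!) [\<phi>, \<psi>]" "PVar 0" "PVar 1"] by simp

lemma Int_S: "\<Gamma> \<tturnstile> Imp (Imp \<phi> (Imp \<psi> \<chi>)) (Imp (Imp \<phi> \<psi>) (Imp \<phi> \<chi>))"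
  using Int[OF ipc_S, of \<Gamma> "(!) [\<phi>, \<psi>, \<chi>]" "PVar 0" "PVar 1" "PVar 2"] by simp

lemma entails_mono: "\<Gamma> \<tturnstile> \<phi> \<Longrightarrow> \<Gamma> \<subseteq> \<Delta> \<Longrightarrow> \<Delta> \<tturnstile> \<phi>"
  by (induction rule: entails.induct) (auto intro: entails.intros)

lemma entails_cut: "\<Delta> \<tturnstile> \<phi> \<Longrightarrow> (\<And>\<psi>. \<psi> \<in> \<Delta> \<Longrightarrow> \<Gamma> \<tturnstile> \<psi>) \<Longrightarrow> \<Gamma> \<tturnstile> \<phi>"
  by (induction rule: entails.induct) (auto intro: entails.intros)

lemma entails_empty: "{} \<tturnstile> \<phi> \<longleftrightarrow> P \<turnstile> \<phi>"
proof
  show "{} \<tturnstile> \<phi> \<Longrightarrow> P \<turnstile> \<phi>"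
    by (induction rule: entails.induct) (auto intro: derivable.MP)
qed (rule Thm)

lemma deduction: "insert \<phi> \<Gamma> \<tturnstile> \<psi> \<Longrightarrow> \<Gamma> \<tturnstile> Imp \<phi> \<psi>"
proof (induction rule: entails.induct)
  case (Hyp \<psi>)
  show ?case
  proof (cases "\<psi> = \<phi>")
    case True
    \<comment> \<open>The combinatory identity S K K.\<close>
    have "\<Gamma> \<tturnstile> Imp \<phi> \<phi>"
      by (rule entails.MP[OF entails.MP[OF Int_S Int_K] Int_K[of _ _ \<phi>]])
    with True show ?thesis by simp
  next
    case False
    with Hyp show ?thesis by (auto intro: entails.MP[OF Int_K] entails.Hyp)
  qed
next
  case (Thm \<psi>)
  then show ?case by (auto intro: entails.MP[OF Int_K] entails.Thm)
next
  case (MP \<psi> \<chi>)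
  then show ?case by (blast intro: entails.MP[OF entails.MP[OF Int_S]])
qed

lemma entails_Imp_iff: "\<Gamma> \<tturnstile> Imp \<phi> \<psi> \<longleftrightarrow> insert \<phi> \<Gamma> \<tturnstile> \<psi>"
proof
  assume "\<Gamma> \<tturnstile> Imp \<phi> \<psi>"
  then have "insert \<phi> \<Gamma> \<tturnstile> Imp \<phi> \<psi>" by (rule entails_mono) auto
  then show "insert \<phi> \<Gamma> \<tturnstile> \<psi>" by (auto intro: MP Hyp)
qed (rule deduction)

lemma entails_And_iff: "\<Gamma> \<tturnstile> And \<phi> \<psi> \<longleftrightarrow> \<Gamma> \<tturnstile> \<phi> \<and> \<Gamma> \<tturnstile> \<psi>"
  using Int[OF ipc_andI, of \<Gamma> "(!) [\<phi>, \<psi>]" "PVar 0" "PVar 1"]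
    Int[OF ipc_andE1, of \<Gamma> "(!) [\<phi>, \<psi>]" "PVar 0" "PVar 1"]
    Int[OF ipc_andE2, of \<Gamma> "(!) [\<phi>, \<psi>]" "PVar 0" "PVar 1"]
  by (auto intro: MP)

lemma entails_OrI1: "\<Gamma> \<tturnstile> \<phi> \<Longrightarrow> \<Gamma> \<tturnstile> Or \<phi> \<psi>"
  using Int[OF ipc_orI1, of \<Gamma> "(!) [\<phi>, \<psi>]" "PVar 0" "PVar 1"] by (auto intro: MP)

lemma entails_OrI2: "\<Gamma> \<tturnstile> \<psi> \<Longrightarrow> \<Gamma> \<tturnstile> Or \<phi> \<psi>"
  \<comment> \<open>Schematic variables are instantiated in order of first occurrence; here
    \<open>B\<close> precedes \<open>A\<close>, which swaps the indices.\<close>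
  using Int[OF ipc_orI2, of \<Gamma> "(!) [\<phi>, \<psi>]" "PVar 1" "PVar 0"] by (auto intro: MP)

lemma entails_OrE:
  assumes "\<Gamma> \<tturnstile> Or \<phi> \<psi>" "insert \<phi> \<Gamma> \<tturnstile> \<chi>" "insert \<psi> \<Gamma> \<tturnstile> \<chi>"
  shows "\<Gamma> \<tturnstile> \<chi>"
proof -
  have "\<Gamma> \<tturnstile> Imp (Imp \<phi> \<chi>) (Imp (Imp \<psi> \<chi>) (Imp (Or \<phi> \<psi>) \<chi>))"
    using Int[OF ipc_orE, of \<Gamma> "(!) [\<phi>, \<psi>, \<chi>]" "PVar 0" "PVar 2" "PVar 1"] by simp
  from MP[OF MP[OF MP[OF this]]] show ?thesis using assms by (simp add: entails_Imp_iff)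
qed

lemma entails_BotE: "\<Gamma> \<tturnstile> Bot \<Longrightarrow> \<Gamma> \<tturnstile> \<phi>"
  using Int[OF ipc_botE, of \<Gamma> "\<lambda>_. \<phi>" "PVar 0"] by (auto intro: MP)

section \<open>Finite conjunctions and disjunctions\<close>

lemma entails_Conj_iff: "\<Gamma> \<tturnstile> Conj \<phi>s \<longleftrightarrow> (\<forall>\<phi>\<in>set \<phi>s. \<Gamma> \<tturnstile> \<phi>)"
  by (induction \<phi>s rule: Conj.induct) (auto simp: entails_And_iff entails_Imp_iff Hyp)

lemma entails_Everyone_iff: "\<Gamma> \<tturnstile> Everyone \<phi> \<longleftrightarrow> (\<forall>a. \<Gamma> \<tturnstile> Know a \<phi>)"
  by (auto simp: Everyone_def entails_Conj_iff set_agents)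

lemma entails_DisjI: "\<phi> \<in> set \<phi>s \<Longrightarrow> \<Gamma> \<tturnstile> \<phi> \<Longrightarrow> \<Gamma> \<tturnstile> Disj \<phi>s"
  by (induction \<phi>s) (auto intro: entails_OrI1 entails_OrI2)

lemma entails_Disj_left: "(\<And>\<phi>. \<phi> \<in> set \<phi>s \<Longrightarrow> {\<phi>} \<tturnstile> \<psi>) \<Longrightarrow> {Disj \<phi>s} \<tturnstile> \<psi>"
proof (induction \<phi>s)
  case Nil
  show ?case by (auto intro: entails_BotE Hyp)
next
  case (Cons \<phi> \<phi>s)
  have "{\<phi>} \<tturnstile> \<psi>" "{Disj \<phi>s} \<tturnstile> \<psi>" using Cons by auto
  then have "insert \<phi> {Or \<phi> (Disj \<phi>s)} \<tturnstile> \<psi>" "insert (Disj \<phi>s) {Or \<phi> (Disj \<phi>s)} \<tturnstile> \<psi>"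
    by (auto intro: entails_mono)
  then show ?case by (auto intro: entails_OrE[of _ \<phi> "Disj \<phi>s"] Hyp)
qed

text \<open>By induction on the derivation: theorems are boxed by \<open>Nec\<close>, and modus
  ponens passes under \<open>Know a\<close> by axiom K. Read contrapositively, it is the source of
  accessible worlds.\<close>

lemma entails_Know:
  assumes "\<Delta> \<tturnstile> \<chi>" "\<And>\<psi>. \<psi> \<in> \<Delta> \<Longrightarrow> \<Gamma> \<tturnstile> Know a \<psi>"
  shows "\<Gamma> \<tturnstile> Know a \<chi>"
  using assms
proof (induction rule: entails.induct)
  case (MP \<phi> \<psi>)
  have "\<Gamma> \<tturnstile> Imp (Know a (Imp \<phi> \<psi>)) (Imp (Know a \<phi>) (Know a \<psi>))"
    using ICK_subset by (intro Thm Ax) (auto simp: ICK_def ax_K_def)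
  with MP show ?case by (blast intro: entails.MP)
qed (auto intro: Thm Nec)

lemma entails_Common_unfold:
  assumes "\<Gamma> \<tturnstile> Common \<phi>"
  shows "\<Gamma> \<tturnstile> \<phi>" "\<Gamma> \<tturnstile> Know a (Common \<phi>)"
proof -
  have "\<Gamma> \<tturnstile> Iff (Common \<phi>) (And \<phi> (Everyone (Common \<phi>)))"
    using ICK_subset by (intro Thm Ax) (auto simp: ICK_def ax_Fix_def)
  then have "\<Gamma> \<tturnstile> And \<phi> (Everyone (Common \<phi>))"
    \<comment> \<open>The instance splits the biconditional into its two implications but leaves the
      conjunction to be proved intact.\<close>
    using assms by (auto simp: entails_And_iff[of _ "Imp _ _"] intro: MP)
  then show "\<Gamma> \<tturnstile> \<phi>" "\<Gamma> \<tturnstile> Know a (Common \<phi>)"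
    by (auto simp: entails_And_iff entails_Everyone_iff)
qed

text \<open>\<open>Ind\<close> gives only \<open>Common \<chi>\<close> from an invariant
  \<open>\<chi>\<close>; \<open>Mon\<close> then weakens it to \<open>Common \<phi>\<close>. Both
  rules need theorems as premises, so \<open>\<chi>\<close> has to be the sole hypothesis.\<close>

lemma entails_Common_induct:
  assumes "\<And>a. {\<chi>} \<tturnstile> Know a \<chi>" "{\<chi>} \<tturnstile> \<phi>"
  shows "{\<chi>} \<tturnstile> Common \<phi>"
proof -
  have "{} \<tturnstile> Imp \<chi> (Everyone \<chi>)" "{} \<tturnstile> Imp \<chi> \<phi>"
    using assms by (auto simp: entails_Everyone_iff entails_Imp_iff)
  then have "{\<chi>} \<tturnstile> Imp \<chi> (Common \<chi>)" "{\<chi>} \<tturnstile> Imp (Common \<chi>) (Common \<phi>)"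
    by (auto simp: entails_empty intro: Thm Ind Mon)
  then show ?thesis by (blast intro: MP Hyp)
qed

end

section \<open>Prime theories in a finite set of formulae\<close>

text \<open>\<open>Bot\<close> is present as a subformula of the added negations. The formulae
  \<open>Know a (Common \<phi>)\<close> are listed outright, since reaching them by recursion would
  not terminate.\<close>

primrec closure :: "('a::finite, 'p) fm \<Rightarrow> ('a, 'p) fm set" where
  "closure Bot = {Bot}"
| "closure (Atom p) = {Atom p}"
| "closure (And \<phi> \<psi>) = insert (And \<phi> \<psi>) (closure \<phi> \<union> closure \<psi>)"
| "closure (Or \<phi> \<psi>) = insert (Or \<phi> \<psi>) (closure \<phi> \<union> closure \<psi>)"
| "closure (Imp \<phi> \<psi>) = insert (Imp \<phi> \<psi>) (closure \<phi> \<union> closure \<psi>)"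
| "closure (Know a \<phi>) = {Know a \<phi>, Neg (Know a \<phi>), Bot} \<union> closure \<phi>"
| "closure (Common \<phi>) = {Common \<phi>, Bot} \<union> range (\<lambda>a. Know a (Common \<phi>))
     \<union> range (\<lambda>a. Neg (Know a (Common \<phi>))) \<union> closure \<phi>"

lemma finite_closure: "finite (closure \<phi>)"
  by (induction \<phi>) auto

lemma self_in_closure: "\<phi> \<in> closure \<phi>"
  by (cases \<phi>) auto

lemma closure_And:
  "And \<phi> \<psi> \<in> closure \<theta> \<Longrightarrow> \<phi> \<in> closure \<theta> \<and> \<psi> \<in> closure \<theta>"
  by (induction \<theta>) (auto simp: self_in_closure)

lemma closure_Or:
  "Or \<phi> \<psi> \<in> closure \<theta> \<Longrightarrow> \<phi> \<in> closure \<theta> \<and> \<psi> \<in> closure \<theta>"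
  by (induction \<theta>) (auto simp: self_in_closure)

lemma closure_Imp:
  "Imp \<phi> \<psi> \<in> closure \<theta> \<Longrightarrow> \<phi> \<in> closure \<theta> \<and> \<psi> \<in> closure \<theta>"
  by (induction \<theta>) (auto simp: self_in_closure)

lemma closure_Know:
  "Know a \<phi> \<in> closure \<theta> \<Longrightarrow> \<phi> \<in> closure \<theta> \<and> Neg (Know a \<phi>) \<in> closure \<theta>"
  by (induction \<theta>) (auto simp: self_in_closure)

lemma closure_Common:
  "Common \<phi> \<in> closure \<theta> \<Longrightarrow> \<phi> \<in> closure \<theta> \<and> Know b (Common \<phi>) \<in> closure \<theta>"
  by (induction \<theta>) (auto simp: self_in_closure)

locale finite_canonical = epistemic_logic P for P :: "('a::finite, 'p) fm set" +
  fixes \<theta> :: "('a, 'p) fm"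
begin

text \<open>Primeness asks that the disjuncts, not the disjunction, lie in the closure. This covers
  \<open>Or (Neg (Know a \<phi>)) (Know a \<phi>)\<close>, which may lie outside.\<close>

definition prime_theory :: "('a, 'p) fm set \<Rightarrow> bool" where
  "prime_theory \<Gamma> \<longleftrightarrow> \<Gamma> \<subseteq> closure \<theta> \<and> \<not> \<Gamma> \<tturnstile> Bot \<and>
     (\<forall>\<phi>\<in>closure \<theta>. \<Gamma> \<tturnstile> \<phi> \<longrightarrow> \<phi> \<in> \<Gamma>) \<and>
     (\<forall>\<phi>\<in>closure \<theta>. \<forall>\<psi>\<in>closure \<theta>. \<Gamma> \<tturnstile> Or \<phi> \<psi> \<longrightarrow> \<phi> \<in> \<Gamma> \<or> \<psi> \<in> \<Gamma>)"

lemma prime_theory_subset: "prime_theory \<Gamma> \<Longrightarrow> \<Gamma> \<subseteq> closure \<theta>"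
  by (simp add: prime_theory_def)

lemma prime_theory_consistent: "prime_theory \<Gamma> \<Longrightarrow> \<not> \<Gamma> \<tturnstile> Bot"
  by (simp add: prime_theory_def)

lemma prime_theory_in_iff: "prime_theory \<Gamma> \<Longrightarrow> \<phi> \<in> closure \<theta> \<Longrightarrow> \<phi> \<in> \<Gamma> \<longleftrightarrow> \<Gamma> \<tturnstile> \<phi>"
  by (auto simp: prime_theory_def intro: Hyp)

lemma prime_theory_prime:
  "prime_theory \<Gamma> \<Longrightarrow> \<phi> \<in> closure \<theta> \<Longrightarrow> \<psi> \<in> closure \<theta> \<Longrightarrow> \<Gamma> \<tturnstile> Or \<phi> \<psi> \<Longrightarrow> \<phi> \<in> \<Gamma> \<or> \<psi> \<in> \<Gamma>"
  by (simp add: prime_theory_def)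

lemma finite_prime_theories: "finite {\<Gamma>. prime_theory \<Gamma>}"
  by (rule finite_subset[of _ "Pow (closure \<theta>)"])
    (auto simp: finite_closure dest: prime_theory_subset)

text \<open>The closure is finite, so some superset of \<open>X\<close> inside it is maximal among
  those not entailing \<open>\<chi>\<close>. The formula \<open>\<chi>\<close> itself may lie
  outside the closure, as the disjunction used for common knowledge may.\<close>

lemma Lindenbaum:
  assumes "X \<subseteq> closure \<theta>" "\<not> X \<tturnstile> \<chi>"
  obtains \<Theta> where "prime_theory \<Theta>" "X \<subseteq> \<Theta>" "\<not> \<Theta> \<tturnstile> \<chi>"
proof -
  define M where "M = {\<Theta>. X \<subseteq> \<Theta> \<and> \<Theta> \<subseteq> closure \<theta> \<and> \<not> \<Theta> \<tturnstile> \<chi>}"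
  have "M \<subseteq> Pow (closure \<theta>)" by (auto simp: M_def)
  then have "finite M" by (simp add: finite_closure finite_subset)
  moreover have "M \<noteq> {}" using assms by (auto simp: M_def)
  ultimately obtain \<Theta> where "\<Theta> \<in> M" and max: "\<forall>\<Delta>\<in>M. \<Theta> \<subseteq> \<Delta> \<longrightarrow> \<Theta> = \<Delta>"
    by (meson finite_has_maximal)
  then have \<Theta>: "X \<subseteq> \<Theta>" "\<Theta> \<subseteq> closure \<theta>" "\<not> \<Theta> \<tturnstile> \<chi>" by (auto simp: M_def)
  \<comment> \<open>Maximality: adding any missing formula of the closure yields
    \<open>\<chi>\<close>. Deductive closure and primeness both follow from this.\<close>
  have ins: "insert \<phi> \<Theta> \<tturnstile> \<chi>" if "\<phi> \<in> closure \<theta>" "\<phi> \<notin> \<Theta>" for \<phi>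
  proof (rule ccontr)
    assume "\<not> insert \<phi> \<Theta> \<tturnstile> \<chi>"
    then have "insert \<phi> \<Theta> \<in> M" using \<Theta> that by (auto simp: M_def)
    then show False using max that by blast
  qed
  have "prime_theory \<Theta>"
    unfolding prime_theory_def
  proof (intro conjI ballI impI)
    show "\<Theta> \<subseteq> closure \<theta>" by (rule \<Theta>)
    show "\<not> \<Theta> \<tturnstile> Bot" using \<Theta> entails_BotE by blast
    show "\<phi> \<in> \<Theta>" if "\<phi> \<in> closure \<theta>" "\<Theta> \<tturnstile> \<phi>" for \<phi>
    proof (rule ccontr)
      assume "\<phi> \<notin> \<Theta>"
      then have "\<Theta> \<tturnstile> Imp \<phi> \<chi>" using ins that(1) by (simp add: entails_Imp_iff)
      then show False using MP that(2) \<Theta> by blast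
    qed
    show "\<phi> \<in> \<Theta> \<or> \<psi> \<in> \<Theta>" if "\<phi> \<in> closure \<theta>" "\<psi> \<in> closure \<theta>" "\<Theta> \<tturnstile> Or \<phi> \<psi>" for \<phi> \<psi>
      using ins[OF that(1)] ins[OF that(2)] entails_OrE[OF that(3)] \<Theta> by blast
  qed
  then show ?thesis using \<Theta> that by blast
qed

end

section \<open>The canonical model\<close>

text \<open>What the truth lemma and confluence ask of accessibility, which differs between the
  systems. \<open>R_antimono\<close> is triangle confluence. In \<open>R_witness\<close> the formula
  \<open>\<chi>\<close> is arbitrary, because it is later applied to a disjunction of
  worlds.\<close>

locale canonical_model = finite_canonical P \<theta> for P :: "('a::finite, 'p) fm set" and \<theta> +
  fixes R :: "'a \<Rightarrow> ('a, 'p) fm set \<Rightarrow> ('a, 'p) fm set \<Rightarrow> bool"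
  assumes R_antimono: "prime_theory \<Gamma> \<Longrightarrow> prime_theory \<Delta> \<Longrightarrow> prime_theory \<Theta> \<Longrightarrow>
      \<Gamma> \<subseteq> \<Delta> \<Longrightarrow> R a \<Delta> \<Theta> \<Longrightarrow> R a \<Gamma> \<Theta>"
    and R_Know: "prime_theory \<Gamma> \<Longrightarrow> prime_theory \<Delta> \<Longrightarrow> R a \<Gamma> \<Delta> \<Longrightarrow> Know a \<phi> \<in> \<Gamma> \<Longrightarrow> \<phi> \<in> \<Delta>"
    and R_witness: "prime_theory \<Gamma> \<Longrightarrow> \<not> \<Gamma> \<tturnstile> Know a \<chi> \<Longrightarrow>
      \<exists>\<Delta>. prime_theory \<Delta> \<and> R a \<Gamma> \<Delta> \<and> \<not> \<Delta> \<tturnstile> \<chi>"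
begin

definition canonical_frame :: "(('a, 'p) fm set, 'a) frame" where
  "canonical_frame =
     \<lparr>worlds = {\<Gamma>. prime_theory \<Gamma>},
      le = {(\<Gamma>, \<Delta>). prime_theory \<Gamma> \<and> prime_theory \<Delta> \<and> \<Gamma> \<subseteq> \<Delta>},
      acc = (\<lambda>a. {(\<Gamma>, \<Delta>). prime_theory \<Gamma> \<and> prime_theory \<Delta> \<and> R a \<Gamma> \<Delta>})\<rparr>"

definition canonical_val :: "('a, 'p) fm set \<Rightarrow> 'p set" where
  "canonical_val \<Gamma> = {p. Atom p \<in> \<Gamma>}"

abbreviation reach :: "('a, 'p) fm set rel" where
  "reach \<equiv> (\<Union>a. acc canonical_frame a)\<^sup>*"

lemma reach_prime_theory: "(\<Gamma>, \<Delta>) \<in> reach \<Longrightarrow> prime_theory \<Gamma> \<Longrightarrow> prime_theory \<Delta>"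
  by (induction rule: rtrancl_induct) (auto simp: canonical_frame_def)

text \<open>The formula that travels along the path is \<open>Common \<phi>\<close>: by Fix a world
  containing it contains \<open>Know a (Common \<phi>)\<close>, which is in the closure. At the end
  Fix gives \<open>\<phi>\<close>.\<close>

lemma reach_Common:
  assumes "(\<Gamma>, \<Delta>) \<in> reach" "prime_theory \<Gamma>" "Common \<phi> \<in> \<Gamma>"
  shows "\<phi> \<in> \<Delta>"
proof -
  have Cl: "Common \<phi> \<in> closure \<theta>" using assms prime_theory_subset by blast
  have "Common \<phi> \<in> \<Delta>"
    using assms
  proof (induction rule: rtrancl_induct)
    case (step \<Delta> \<Theta>)
    then obtain a where a: "prime_theory \<Delta>" "prime_theory \<Theta>" "R a \<Delta> \<Theta>" "Common \<phi> \<in> \<Delta>"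
      by (auto simp: canonical_frame_def)
    then have "Know a (Common \<phi>) \<in> \<Delta>"
      using closure_Common[OF Cl, of a] prime_theory_in_iff[of \<Delta>]
        entails_Common_unfold(2)[OF Hyp[of "Common \<phi>" \<Delta>]] by blast
    then show ?case using R_Know a by blast
  qed
  then show ?thesis
    using closure_Common[OF Cl] reach_prime_theory[OF assms(1,2)] prime_theory_in_iff[of \<Delta>]
      entails_Common_unfold(1)[OF Hyp[of "Common \<phi>" \<Delta>]] by blast
qed

text \<open>The disjunction \<open>\<chi>\<close> describing the reachable worlds is the induction
  invariant: it follows from \<open>\<Gamma>\<close>, implies \<open>\<phi>\<close> and is preserved
  by every \<open>Know a\<close>.\<close>

lemma entails_Common_if_reach:
  assumes "prime_theory \<Gamma>" and reach: "\<And>\<Delta>. (\<Gamma>, \<Delta>) \<in> reach \<Longrightarrow> \<phi> \<in> \<Delta>"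
  shows "\<Gamma> \<tturnstile> Common \<phi>"
proof -
  \<comment> \<open>Any enumeration of the finite set \<open>\<Delta>\<close> will do, since only
    derivability of the conjunction matters.\<close>
  define conj where "conj \<Delta> = Conj (SOME \<phi>s. set \<phi>s = \<Delta>)" for \<Delta> :: "('a, 'p) fm set"
  have conj: "\<Theta> \<tturnstile> conj \<Delta> \<longleftrightarrow> (\<forall>\<psi>\<in>\<Delta>. \<Theta> \<tturnstile> \<psi>)" if "prime_theory \<Delta>" for \<Theta> \<Delta>
  proof -
    have "finite \<Delta>" using that prime_theory_subset finite_closure finite_subset by blast
    then have "set (SOME \<phi>s. set \<phi>s = \<Delta>) = \<Delta>" by (rule someI_ex[OF finite_list])
    then show ?thesis by (simp add: conj_def entails_Conj_iff)
  qed
  have "finite {\<Delta>. (\<Gamma>, \<Delta>) \<in> reach}"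
    by (rule finite_subset[OF _ finite_prime_theories])
      (use assms(1) reach_prime_theory in blast)
  then obtain \<Delta>s where \<Delta>s: "set \<Delta>s = {\<Delta>. (\<Gamma>, \<Delta>) \<in> reach}" using finite_list by blast
  have pr: "prime_theory \<Delta>" if "\<Delta> \<in> set \<Delta>s" for \<Delta>
    using that \<Delta>s assms(1) reach_prime_theory by blast
  define \<chi> where "\<chi> = Disj (map conj \<Delta>s)"
  have \<chi>I: "\<Delta> \<tturnstile> \<chi>" if "\<Delta> \<in> set \<Delta>s" for \<Delta>
    unfolding \<chi>_def
    by (rule entails_DisjI[of "conj \<Delta>"]) (use that conj[OF pr[OF that]] in \<open>auto intro: Hyp\<close>)
  have \<chi>E: "{\<chi>} \<tturnstile> \<psi>" if "\<And>\<Delta>. \<Delta> \<in> set \<Delta>s \<Longrightarrow> \<Delta> \<tturnstile> \<psi>" for \<psi>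
    unfolding \<chi>_def
  proof (rule entails_Disj_left)
    fix \<delta> assume "\<delta> \<in> set (map conj \<Delta>s)"
    then obtain \<Delta> where \<Delta>: "\<Delta> \<in> set \<Delta>s" "\<delta> = conj \<Delta>" by auto
    have "{\<delta>} \<tturnstile> \<alpha>" if "\<alpha> \<in> \<Delta>" for \<alpha>
      using conj[OF pr[OF \<Delta>(1)], of "{\<delta>}"] \<Delta>(2) that Hyp[of \<delta> "{\<delta>}"] by blast
    then show "{\<delta>} \<tturnstile> \<psi>" using entails_cut[OF \<open>\<And>\<Delta>. \<Delta> \<in> set \<Delta>s \<Longrightarrow> \<Delta> \<tturnstile> \<psi>\<close>[OF \<Delta>(1)]] by blast
  qed
  \<comment> \<open>A world accessible from \<open>\<Delta>\<close> that refutes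
    \<open>\<chi>\<close> would be reachable from \<open>\<Gamma>\<close>, hence described by one of
    the disjuncts of \<open>\<chi>\<close>.\<close>
  have "\<Delta> \<tturnstile> Know a \<chi>" if \<Delta>: "\<Delta> \<in> set \<Delta>s" for \<Delta> a
  proof (rule ccontr)
    assume "\<not> \<Delta> \<tturnstile> Know a \<chi>"
    then obtain \<Theta> where \<Theta>: "prime_theory \<Theta>" "R a \<Delta> \<Theta>" "\<not> \<Theta> \<tturnstile> \<chi>"
      using R_witness[OF pr[OF \<Delta>]] by blast
    then have "(\<Delta>, \<Theta>) \<in> (\<Union>a. acc canonical_frame a)"
      using pr[OF \<Delta>] by (auto simp: canonical_frame_def)
    then have "\<Theta> \<in> set \<Delta>s"
      using \<Delta> by (auto simp: \<Delta>s intro: rtrancl_into_rtrancl)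
    then show False using \<Theta>(3) \<chi>I by blast
  qed
  then have "{\<chi>} \<tturnstile> Common \<phi>"
    by (intro entails_Common_induct \<chi>E) (use reach \<Delta>s in \<open>auto intro: Hyp\<close>)
  moreover have "\<Gamma> \<tturnstile> \<chi>" by (rule \<chi>I) (simp add: \<Delta>s)
  ultimately show ?thesis by (auto intro: entails_cut)
qed

text \<open>In the cases \<open>Imp\<close>, \<open>Know\<close> and \<open>Common\<close>,
  membership in \<open>\<Gamma>\<close> is first matched with membership in all relevant worlds, by
  \<open>Lindenbaum\<close>, \<open>R_witness\<close> and \<open>entails_Common_if_reach\<close>
  respectively; the induction hypothesis then turns membership into truth.\<close>

lemma truth_lemma:
  "prime_theory \<Gamma> \<Longrightarrow> \<phi> \<in> closure \<theta> \<Longrightarrow> sat canonical_frame canonical_val \<Gamma> \<phi> \<longleftrightarrow> \<phi> \<in> \<Gamma>"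
proof (induction \<phi> arbitrary: \<Gamma>)
  case Bot
  then show ?case using prime_theory_consistent Hyp by fastforce
next
  case (Atom p)
  then show ?case by (simp add: canonical_val_def)
next
  case (And \<phi> \<psi>)
  then show ?case
    using closure_And[OF And.prems(2)] by (simp add: prime_theory_in_iff entails_And_iff)
next
  case (Or \<phi> \<psi>)
  have cl: "\<phi> \<in> closure \<theta>" "\<psi> \<in> closure \<theta>" using closure_Or[OF Or.prems(2)] by auto
  have "Or \<phi> \<psi> \<in> \<Gamma> \<longleftrightarrow> \<phi> \<in> \<Gamma> \<or> \<psi> \<in> \<Gamma>"
    using prime_theory_prime[OF Or.prems(1) cl] prime_theory_in_iff[OF Or.prems]
      entails_OrI1 entails_OrI2 Hyp by metis
  then show ?case using Or cl by simp
next
  case (Imp \<phi> \<psi>)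
  have cl: "\<phi> \<in> closure \<theta>" "\<psi> \<in> closure \<theta>" using closure_Imp[OF Imp.prems(2)] by auto
  have "Imp \<phi> \<psi> \<in> \<Gamma> \<longleftrightarrow> (\<forall>\<Delta>. prime_theory \<Delta> \<longrightarrow> \<Gamma> \<subseteq> \<Delta> \<longrightarrow> \<phi> \<in> \<Delta> \<longrightarrow> \<psi> \<in> \<Delta>)"
  proof
    assume "Imp \<phi> \<psi> \<in> \<Gamma>"
    moreover have "\<psi> \<in> \<Delta>" if "prime_theory \<Delta>" "Imp \<phi> \<psi> \<in> \<Delta>" "\<phi> \<in> \<Delta>" for \<Delta>
      using MP[OF Hyp[OF that(2)] Hyp[OF that(3)]] prime_theory_in_iff[OF that(1) cl(2)] by simp
    ultimately show "\<forall>\<Delta>. prime_theory \<Delta> \<longrightarrow> \<Gamma> \<subseteq> \<Delta> \<longrightarrow> \<phi> \<in> \<Delta> \<longrightarrow> \<psi> \<in> \<Delta>"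
      by blast
  next
    assume *: "\<forall>\<Delta>. prime_theory \<Delta> \<longrightarrow> \<Gamma> \<subseteq> \<Delta> \<longrightarrow> \<phi> \<in> \<Delta> \<longrightarrow> \<psi> \<in> \<Delta>"
    show "Imp \<phi> \<psi> \<in> \<Gamma>"
    proof (rule ccontr)
      assume "Imp \<phi> \<psi> \<notin> \<Gamma>"
      then have "\<not> insert \<phi> \<Gamma> \<tturnstile> \<psi>"
        by (simp add: prime_theory_in_iff[OF Imp.prems] entails_Imp_iff)
      moreover have "insert \<phi> \<Gamma> \<subseteq> closure \<theta>"
        using cl prime_theory_subset[OF Imp.prems(1)] by simp
      ultimately obtain \<Delta> where "prime_theory \<Delta>" "insert \<phi> \<Gamma> \<subseteq> \<Delta>" "\<not> \<Delta> \<tturnstile> \<psi>"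
        using Lindenbaum by metis
      then show False using * Hyp by blast
    qed
  qed
  moreover have "sat canonical_frame canonical_val \<Gamma> (Imp \<phi> \<psi>) \<longleftrightarrow>
      (\<forall>\<Delta>. prime_theory \<Delta> \<longrightarrow> \<Gamma> \<subseteq> \<Delta> \<longrightarrow>
        sat canonical_frame canonical_val \<Delta> \<phi> \<longrightarrow> sat canonical_frame canonical_val \<Delta> \<psi>)"
    using Imp.prems(1) by (auto simp: canonical_frame_def)
  ultimately show ?case using Imp.IH cl by simp
next
  case (Know a \<phi>)
  have cl: "\<phi> \<in> closure \<theta>" using closure_Know[OF Know.prems(2)] by simp
  have "Know a \<phi> \<in> \<Gamma> \<longleftrightarrow> (\<forall>\<Delta>. (\<Gamma>, \<Delta>) \<in> acc canonical_frame a \<longrightarrow> \<phi> \<in> \<Delta>)"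
  proof
    assume "Know a \<phi> \<in> \<Gamma>"
    then show "\<forall>\<Delta>. (\<Gamma>, \<Delta>) \<in> acc canonical_frame a \<longrightarrow> \<phi> \<in> \<Delta>"
      using R_Know by (auto simp: canonical_frame_def)
  next
    assume "\<forall>\<Delta>. (\<Gamma>, \<Delta>) \<in> acc canonical_frame a \<longrightarrow> \<phi> \<in> \<Delta>"
    then have "\<not> (\<exists>\<Delta>. prime_theory \<Delta> \<and> R a \<Gamma> \<Delta> \<and> \<not> \<Delta> \<tturnstile> \<phi>)"
      using Know.prems(1) by (auto simp: canonical_frame_def intro: Hyp)
    then show "Know a \<phi> \<in> \<Gamma>"
      using R_witness[OF Know.prems(1)] by (auto simp: prime_theory_in_iff[OF Know.prems])
  qed
  moreover have "prime_theory \<Delta>" if "(\<Gamma>, \<Delta>) \<in> acc canonical_frame a" for \<Delta>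
    using that by (simp add: canonical_frame_def)
  ultimately show ?case using Know.IH cl by auto
next
  case (Common \<phi>)
  have cl: "\<phi> \<in> closure \<theta>" using closure_Common[OF Common.prems(2)] by simp
  have "Common \<phi> \<in> \<Gamma> \<longleftrightarrow> (\<forall>\<Delta>. (\<Gamma>, \<Delta>) \<in> reach \<longrightarrow> \<phi> \<in> \<Delta>)"
    using reach_Common[of \<Gamma>] entails_Common_if_reach[of \<Gamma> \<phi>] Common.prems
    by (auto simp: prime_theory_in_iff[OF Common.prems])
  then show ?case
    using Common.IH[OF _ cl] reach_prime_theory[OF _ Common.prems(1)] by auto
qed

text \<open>Underivability of \<open>\<theta>\<close> provides a world, by extending the empty set.
  Inclusion is a partial order because worlds are sets of formulae.\<close>

lemma canonical_frame_epistemic: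
  assumes "\<not> P \<turnstile> \<theta>"
  shows "epistemic_frame canonical_frame"
proof -
  obtain \<Theta> where "prime_theory \<Theta>"
    using Lindenbaum[of "{}" \<theta>] assms entails_empty by blast
  then have "worlds canonical_frame \<noteq> {}" by (auto simp: canonical_frame_def)
  moreover have "partial_order_on (worlds canonical_frame) (le canonical_frame)"
    by (auto simp: canonical_frame_def partial_order_on_def preorder_on_def
        refl_on_def trans_def antisym_def)
  moreover have "(\<Gamma>, \<Theta>) \<in> acc canonical_frame a"
    if "(\<Gamma>, \<Delta>) \<in> le canonical_frame" "(\<Delta>, \<Theta>) \<in> acc canonical_frame a" for a \<Gamma> \<Delta> \<Theta>
    using that R_antimono[of \<Gamma> \<Delta> \<Theta> a] by (simp add: canonical_frame_def)
  moreover have "acc canonical_frame a \<subseteq> worlds canonical_frame \<times> worlds canonical_frame" for a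
    by (auto simp: canonical_frame_def)
  ultimately show ?thesis unfolding epistemic_frame_def by blast
qed

lemma canonical_countermodel:
  assumes "\<not> P \<turnstile> \<theta>"
  shows "\<exists>\<Gamma>\<in>worlds canonical_frame. \<not> sat canonical_frame canonical_val \<Gamma> \<theta>"
proof -
  obtain \<Theta> where \<Theta>: "prime_theory \<Theta>" "\<not> \<Theta> \<tturnstile> \<theta>"
    using Lindenbaum[of "{}" \<theta>] assms entails_empty by blast
  then have "\<theta> \<notin> \<Theta>" using Hyp by blast
  then show ?thesis
    using \<Theta> truth_lemma[OF _ self_in_closure] by (auto simp: canonical_frame_def)
qed

lemma canonical_valuation: "valuation canonical_frame canonical_val"
  by (auto simp: valuation_def canonical_frame_def canonical_val_def)

lemma finite_canonical_worlds: "finite (worlds canonical_frame)"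
  by (simp add: canonical_frame_def finite_prime_theories)

end

section \<open>Copying a finite model into an infinite type\<close>

text \<open>Nothing is known about \<open>g\<close> outside \<open>D\<close>, hence the restriction
  of both relations. For a bijection from \<open>D\<close> to the worlds of \<open>F\<close> this is
  an isomorphic copy.\<close>

definition pullback :: "('v \<Rightarrow> 'w) \<Rightarrow> 'v set \<Rightarrow> ('w, 'a) frame \<Rightarrow> ('v, 'a) frame" where
  "pullback g D F =
     \<lparr>worlds = D,
      le = {(x, y). x \<in> D \<and> y \<in> D \<and> (g x, g y) \<in> le F},
      acc = (\<lambda>a. {(x, y). x \<in> D \<and> y \<in> D \<and> (g x, g y) \<in> acc F a})\<rparr>"

lemma sat_pullback:
  assumes "epistemic_frame F" and g: "bij_betw g D (worlds F)"
  shows "x \<in> D \<Longrightarrow> sat (pullback g D F) (V \<circ> g) x \<phi> \<longleftrightarrow> sat F V (g x) \<phi>"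
proof (induction \<phi> arbitrary: x)
  case (Imp \<phi> \<psi>)
  have "le F \<subseteq> worlds F \<times> worlds F"
    using assms(1) by (auto simp: epistemic_frame_def partial_order_on_def preorder_on_def)
  then have "\<exists>y\<in>D. v = g y" if "(u, v) \<in> le F" for u v
    using that bij_betw_imp_surj_on[OF g] by blast
  moreover have "(x, y) \<in> le (pullback g D F) \<longleftrightarrow> y \<in> D \<and> (g x, g y) \<in> le F" for y
    using Imp.prems by (simp add: pullback_def)
  ultimately show ?case using Imp.IH by (simp only: sat.simps) blast
next
  case (Know a \<phi>)
  have "\<exists>y\<in>D. v = g y" if "(u, v) \<in> acc F a" for u v
    using that assms(1) unfolding epistemic_frame_def bij_betw_imp_surj_on[OF g, symmetric] by blast
  moreover have "(x, y) \<in> acc (pullback g D F) a \<longleftrightarrow> y \<in> D \<and> (g x, g y) \<in> acc F a" for y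
    using Know.prems by (simp add: pullback_def)
  ultimately show ?case using Know.IH by (simp only: sat.simps) blast
next
  case (Common \<phi>)
  let ?R = "\<Union>a. acc (pullback g D F) a" and ?S = "\<Union>a. acc F a"
  have 1: "y \<in> D \<and> (g x, g y) \<in> ?S\<^sup>*" if "(x, y) \<in> ?R\<^sup>*" for y
    using that
  proof (induction rule: rtrancl_induct)
    case (step y z)
    then have "z \<in> D" "(g y, g z) \<in> ?S" by (auto simp: pullback_def)
    with step show ?case by (auto intro: rtrancl_into_rtrancl)
  qed (simp add: Common.prems)
  \<comment> \<open>Conversely, a path from \<open>g x\<close> is lifted edge by edge, each endpoint
    being a value of \<open>g\<close> on \<open>D\<close>.\<close>
  have 2: "\<exists>y\<in>D. v = g y \<and> (x, y) \<in> ?R\<^sup>*" if "(g x, v) \<in> ?S\<^sup>*" for v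
    using that
  proof (induction rule: rtrancl_induct)
    case (step v u)
    then obtain y where y: "y \<in> D" "v = g y" "(x, y) \<in> ?R\<^sup>*" by blast
    obtain a where a: "(v, u) \<in> acc F a" using step by blast
    then obtain z where z: "z \<in> D" "u = g z"
      using assms(1) unfolding epistemic_frame_def bij_betw_imp_surj_on[OF g, symmetric] by blast
    then have "(y, z) \<in> ?R" using y a by (auto simp: pullback_def)
    then show ?case using y z by (auto intro: rtrancl_into_rtrancl)
  qed (use Common.prems in blast)
  show ?case using Common.IH 1 2 by (simp only: sat.simps) blast
qed auto

lemma epistemic_frame_pullback:
  assumes "epistemic_frame F" and g: "bij_betw g D (worlds F)"
  shows "epistemic_frame (pullback g D F)"
proof -
  have D: "D \<noteq> {}" "\<And>x. x \<in> D \<Longrightarrow> g x \<in> worlds F"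
    using assms by (auto simp: epistemic_frame_def bij_betw_def)
  have po: "partial_order_on (worlds F) (le F)"
    using assms(1) by (simp add: epistemic_frame_def)
  have "partial_order_on D (le (pullback g D F))"
    unfolding partial_order_on_def preorder_on_def
  proof (intro conjI)
    show "refl_on D (le (pullback g D F))"
      using po D(2) by (auto simp: partial_order_on_def preorder_on_def refl_on_def pullback_def)
    show "trans (le (pullback g D F))"
      by (rule transI) (use po in \<open>auto simp: partial_order_on_def preorder_on_def pullback_def
          dest: transD\<close>)
    \<comment> \<open>Antisymmetry of \<open>le F\<close> equates the images under \<open>g\<close>;
      injectivity then equates the points.\<close>
    show "antisym (le (pullback g D F))"
      by (rule antisymI) (use po bij_betw_imp_inj_on[OF g] in \<open>auto simp: partial_order_on_def
          pullback_def inj_on_def dest: antisymD\<close>)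
  qed (auto simp: pullback_def)
  moreover have "(x, z) \<in> acc (pullback g D F) a"
    if "(x, y) \<in> le (pullback g D F)" "(y, z) \<in> acc (pullback g D F) a" for a x y z
    using that assms(1) by (auto simp: pullback_def epistemic_frame_def)
  moreover have "acc (pullback g D F) a \<subseteq> D \<times> D" for a
    by (auto simp: pullback_def)
  moreover have "worlds (pullback g D F) = D" by (simp add: pullback_def)
  ultimately show ?thesis using D(1) by (simp add: epistemic_frame_def)
qed

section \<open>Transfer of the frame conditions to the copy\<close>

lemma refl_on_pullback:
  "bij_betw g D (worlds F) \<Longrightarrow> refl_on (worlds F) (acc F a) \<Longrightarrow>
     refl_on (worlds (pullback g D F)) (acc (pullback g D F) a)"
  by (auto simp: refl_on_def pullback_def bij_betw_def)

lemma trans_pullback: "trans (acc F a) \<Longrightarrow> trans (acc (pullback g D F) a)"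
  unfolding trans_def pullback_def by simp blast

lemma sym_pullback: "sym (acc F a) \<Longrightarrow> sym (acc (pullback g D F) a)"
  unfolding sym_def pullback_def by simp

text \<open>An infinite type has a finite subset with as many elements as there are canonical
  worlds, and the copy of the model on it refutes an underivable \<open>\<theta>\<close>. In
  \<open>cls\<close> the frame may be taken to be epistemic, as underivability guarantees.\<close>

lemma (in canonical_model) completeness:
  assumes inf: "infinite (UNIV :: 'w set)"
    and cls: "\<And>g (D :: 'w set). epistemic_frame canonical_frame \<Longrightarrow>
        bij_betw g D (worlds canonical_frame) \<Longrightarrow> pullback g D canonical_frame \<in> \<F>"
    and val: "valid_over \<F> \<theta>"
  shows "P \<turnstile> \<theta>"
proof (rule ccontr)
  assume *: "\<not> P \<turnstile> \<theta>"
  obtain D :: "'w set" where D: "finite D" "card D = card (worlds canonical_frame)"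
    using infinite_arbitrarily_large[OF inf] by metis
  obtain g where g: "bij_betw g D (worlds canonical_frame)"
    using finite_same_card_bij[OF D(1) finite_canonical_worlds D(2)] by metis
  note ef = canonical_frame_epistemic[OF *]
  have "\<exists>x\<in>D. \<not> sat canonical_frame canonical_val (g x) \<theta>"
    using canonical_countermodel[OF *] unfolding bij_betw_imp_surj_on[OF g, symmetric] by simp
  then obtain x where "x \<in> D"
      "\<not> sat (pullback g D canonical_frame) (canonical_val \<circ> g) x \<theta>"
    using sat_pullback[OF ef g, of _ canonical_val \<theta>] by metis
  moreover have "valuation (pullback g D canonical_frame) (canonical_val \<circ> g)"
    using canonical_valuation by (simp add: valuation_def pullback_def)
  moreover have "x \<in> worlds (pullback g D canonical_frame)"
    using \<open>x \<in> D\<close> by (simp add: pullback_def)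
  ultimately show False
    using val cls[OF ef g] unfolding valid_over_def by blast
qed

section \<open>The four systems\<close>

text \<open>\<open>X\<close> collects what the new world must contain. It cannot entail
  \<open>\<chi>\<close>, by \<open>entails_Know\<close>, so it extends to a prime theory that does
  not. Each system chooses its own \<open>X\<close>.\<close>

lemma (in finite_canonical) Know_witness:
  assumes "X \<subseteq> closure \<theta>" "\<And>\<psi>. \<psi> \<in> X \<Longrightarrow> \<Gamma> \<tturnstile> Know a \<psi>"
    and "\<not> \<Gamma> \<tturnstile> Know a \<chi>"
  shows "\<exists>\<Delta>. prime_theory \<Delta> \<and> X \<subseteq> \<Delta> \<and> \<not> \<Delta> \<tturnstile> \<chi>"
proof -
  have "\<not> X \<tturnstile> \<chi>" using entails_Know[of X \<chi> \<Gamma> a] assms(2,3) by metis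
  then show ?thesis using Lindenbaum[OF assms(1)] by metis
qed

lemma (in finite_canonical) prime_theory_Know:
  assumes "ax_T \<subseteq> P" "prime_theory \<Gamma>" "Know a \<phi> \<in> \<Gamma>"
  shows "\<phi> \<in> \<Gamma>"
proof -
  have "\<Gamma> \<tturnstile> Imp (Know a \<phi>) \<phi>" using assms(1) by (intro Thm Ax) (auto simp: ax_T_def)
  then have "\<Gamma> \<tturnstile> \<phi>" using assms(3) by (blast intro: MP Hyp)
  then show ?thesis
    using prime_theory_in_iff[OF assms(2)] prime_theory_subset[OF assms(2)] assms(3)
      closure_Know[of a \<phi>] by blast
qed

lemma (in finite_canonical) entails_Know_Know:
  assumes "ax_S4 \<subseteq> P" "Know a \<phi> \<in> \<Gamma>"
  shows "\<Gamma> \<tturnstile> Know a (Know a \<phi>)"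
proof -
  have "\<Gamma> \<tturnstile> Imp (Know a \<phi>) (Know a (Know a \<phi>))"
    using assms(1) by (intro Thm Ax) (auto simp: ax_S4_def)
  then show ?thesis using assms(2) by (blast intro: MP Hyp)
qed

lemma (in finite_canonical) entails_Know_Neg_Know:
  assumes "ax_S5 \<subseteq> P" "Neg (Know a \<phi>) \<in> \<Gamma>"
  shows "\<Gamma> \<tturnstile> Know a (Neg (Know a \<phi>))"
proof -
  have "\<Gamma> \<tturnstile> Imp (Neg (Know a \<phi>)) (Know a (Neg (Know a \<phi>)))"
    using assms(1) by (intro Thm Ax) (auto simp: ax_S5_def)
  then show ?thesis using assms(2) by (blast intro: MP Hyp)
qed

text \<open>With \<open>\<psi>\<close> taken to be \<open>Know a \<phi>\<close>, the premise of
  \<open>ax_Kc\<close> is an identity and its conclusion is excluded middle for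
  \<open>Know a \<phi>\<close>; primeness then decides.\<close>

lemma (in finite_canonical) prime_theory_Know_cases:
  assumes "ax_Kc \<subseteq> P" "prime_theory \<Gamma>" "Know a \<phi> \<in> closure \<theta>"
  shows "Know a \<phi> \<in> \<Gamma> \<or> Neg (Know a \<phi>) \<in> \<Gamma>"
proof -
  have "\<Gamma> \<tturnstile> Imp (Imp (Know a \<phi>) (Know a \<phi>)) (Or (Neg (Know a \<phi>)) (Know a \<phi>))"
    using assms(1) by (intro Thm Ax) (auto simp: ax_Kc_def)
  moreover have "\<Gamma> \<tturnstile> Imp (Know a \<phi>) (Know a \<phi>)" by (simp add: entails_Imp_iff Hyp)
  ultimately have "\<Gamma> \<tturnstile> Or (Neg (Know a \<phi>)) (Know a \<phi>)" by (rule MP)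
  then show ?thesis
    using prime_theory_prime[OF assms(2)] closure_Know[OF assms(3)] assms(3) by blast
qed

lemma (in finite_canonical) not_both_Know_Neg_Know:
  "prime_theory \<Gamma> \<Longrightarrow> Know a \<phi> \<in> \<Gamma> \<Longrightarrow> Neg (Know a \<phi>) \<notin> \<Gamma>"
  using prime_theory_consistent by (blast intro: MP Hyp)

text \<open>Triangle confluence holds because a larger world imposes more conditions on its
  successors. The same relation serves \<open>ICKT\<close>, where axiom T makes it
  reflexive.\<close>

lemma (in finite_canonical) canonical_model_K:
  "canonical_model P \<theta> (\<lambda>a \<Gamma> \<Delta>. \<forall>\<phi>. Know a \<phi> \<in> \<Gamma> \<longrightarrow> \<phi> \<in> \<Delta>)"
proof unfold_locales
  fix \<Gamma> a \<chi> assume *: "prime_theory \<Gamma>" "\<not> \<Gamma> \<tturnstile> Know a \<chi>"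
  show "\<exists>\<Delta>. prime_theory \<Delta> \<and> (\<forall>\<phi>. Know a \<phi> \<in> \<Gamma> \<longrightarrow> \<phi> \<in> \<Delta>) \<and> \<not> \<Delta> \<tturnstile> \<chi>"
    using Know_witness[OF _ _ *(2), of "{\<phi>. Know a \<phi> \<in> \<Gamma>}"]
      prime_theory_subset[OF *(1)] closure_Know[of a _ \<theta>]
    by (simp add: subset_iff Hyp)
qed auto

text \<open>Passing on \<open>Know a \<phi>\<close> itself makes the relation reflexive and
  transitive by its form. The axioms are spent elsewhere: T on \<open>R_Know\<close>, S4 on
  \<open>R_witness\<close>.\<close>

lemma (in finite_canonical) canonical_model_S4:
  assumes "ax_T \<subseteq> P" "ax_S4 \<subseteq> P"
  shows "canonical_model P \<theta> (\<lambda>a \<Gamma> \<Delta>. \<forall>\<phi>. Know a \<phi> \<in> \<Gamma> \<longrightarrow> Know a \<phi> \<in> \<Delta>)"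
proof unfold_locales
  fix \<Gamma> a \<chi> assume *: "prime_theory \<Gamma>" "\<not> \<Gamma> \<tturnstile> Know a \<chi>"
  show "\<exists>\<Delta>. prime_theory \<Delta> \<and> (\<forall>\<phi>. Know a \<phi> \<in> \<Gamma> \<longrightarrow> Know a \<phi> \<in> \<Delta>) \<and> \<not> \<Delta> \<tturnstile> \<chi>"
  proof -
    let ?X = "{Know a \<phi> |\<phi>. Know a \<phi> \<in> \<Gamma>}"
    have "?X \<subseteq> closure \<theta>" using prime_theory_subset[OF *(1)] by auto
    moreover have "\<Gamma> \<tturnstile> Know a \<psi>" if "\<psi> \<in> ?X" for \<psi>
      using that entails_Know_Know[OF assms(2)] by auto
    ultimately have "\<exists>\<Delta>. prime_theory \<Delta> \<and> ?X \<subseteq> \<Delta> \<and> \<not> \<Delta> \<tturnstile> \<chi>"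
      by (rule Know_witness[OF _ _ *(2)])
    then show ?thesis by blast
  qed
qed (auto intro: prime_theory_Know[OF assms(1)])

text \<open>Axiom \<open>K\<^sup>c\<^sub>a\<close> decides every \<open>K\<^sub>a \<psi>\<close> in a prime theory, so worlds comparable by inclusion
  have the same \<open>K\<^sub>a\<close>-formulae; hence an equivalence relation can be triangle confluent.\<close>

lemma (in finite_canonical) canonical_model_S5:
  assumes "ax_T \<subseteq> P" "ax_S4 \<subseteq> P" "ax_Kc \<subseteq> P" "ax_S5 \<subseteq> P"
  shows "canonical_model P \<theta> (\<lambda>a \<Gamma> \<Delta>. \<forall>\<phi>. Know a \<phi> \<in> \<Gamma> \<longleftrightarrow> Know a \<phi> \<in> \<Delta>)"
proof unfold_locales
  \<comment> \<open>If only \<open>\<Delta>\<close> contained \<open>Know a \<phi>\<close>, then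
    \<open>\<Gamma>\<close>, and with it \<open>\<Delta>\<close>, would contain the negation,
    against consistency.\<close>
  have same: "Know a \<phi> \<in> \<Gamma> \<longleftrightarrow> Know a \<phi> \<in> \<Delta>"
    if "prime_theory \<Gamma>" "prime_theory \<Delta>"
      "Know a \<phi> \<in> \<Gamma> \<Longrightarrow> Know a \<phi> \<in> \<Delta>" "Neg (Know a \<phi>) \<in> \<Gamma> \<Longrightarrow> Neg (Know a \<phi>) \<in> \<Delta>"
    for \<Gamma> \<Delta> a \<phi>
    using that(3,4) prime_theory_Know_cases[OF assms(3) that(1), of a \<phi>]
      not_both_Know_Neg_Know[OF that(2), of a \<phi>] prime_theory_subset[OF that(2)] by blast
  { fix \<Gamma> \<Delta> \<Theta> a assume *: "prime_theory \<Gamma>" "prime_theory \<Delta>" "prime_theory \<Theta>"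
      "\<Gamma> \<subseteq> \<Delta>" "\<forall>\<phi>. Know a \<phi> \<in> \<Delta> \<longleftrightarrow> Know a \<phi> \<in> \<Theta>"
    have "\<forall>\<phi>. Know a \<phi> \<in> \<Gamma> \<longleftrightarrow> Know a \<phi> \<in> \<Delta>"
      by (intro allI same) (use * in auto)
    then show "\<forall>\<phi>. Know a \<phi> \<in> \<Gamma> \<longleftrightarrow> Know a \<phi> \<in> \<Theta>" using * by simp }
  { fix \<Gamma> \<Delta> a \<phi> assume "prime_theory \<Gamma>" "prime_theory \<Delta>"
      "\<forall>\<phi>. Know a \<phi> \<in> \<Gamma> \<longleftrightarrow> Know a \<phi> \<in> \<Delta>" "Know a \<phi> \<in> \<Gamma>"
    then show "\<phi> \<in> \<Delta>" using prime_theory_Know[OF assms(1)] by blast }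
  fix \<Gamma> a \<chi> assume *: "prime_theory \<Gamma>" "\<not> \<Gamma> \<tturnstile> Know a \<chi>"
  \<comment> \<open>The negations keep the successor from knowing more than \<open>\<Gamma>\<close>;
    axioms S4 and S5 put the two halves of \<open>?X\<close> under \<open>Know a\<close>.\<close>
  let ?X = "{Know a \<phi> |\<phi>. Know a \<phi> \<in> \<Gamma>} \<union> {Neg (Know a \<phi>) |\<phi>. Neg (Know a \<phi>) \<in> \<Gamma>}"
  have "?X \<subseteq> closure \<theta>" using prime_theory_subset[OF *(1)] by auto
  moreover have "\<Gamma> \<tturnstile> Know a \<psi>" if "\<psi> \<in> ?X" for \<psi>
    using that entails_Know_Know[OF assms(2)] entails_Know_Neg_Know[OF assms(4)] by auto
  ultimately have "\<exists>\<Delta>. prime_theory \<Delta> \<and> ?X \<subseteq> \<Delta> \<and> \<not> \<Delta> \<tturnstile> \<chi>"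
    by (rule Know_witness[OF _ _ *(2)])
  then obtain \<Delta> where "prime_theory \<Delta>" "?X \<subseteq> \<Delta>" "\<not> \<Delta> \<tturnstile> \<chi>"
    by blast
  moreover from this have "\<forall>\<phi>. Know a \<phi> \<in> \<Gamma> \<longleftrightarrow> Know a \<phi> \<in> \<Delta>"
    by (intro allI same[OF *(1)]) auto
  ultimately show "\<exists>\<Delta>. prime_theory \<Delta> \<and> (\<forall>\<phi>. Know a \<phi> \<in> \<Gamma> \<longleftrightarrow> Know a \<phi> \<in> \<Delta>) \<and> \<not> \<Delta> \<tturnstile> \<chi>"
    by blast
qed

section \<open>Completeness of the individual systems\<close>

lemma completeness_ICK:
  assumes "infinite (UNIV :: 'w set)"
    and "valid_over (epistemic_frames :: ('w, 'a::finite) frame set) \<phi>"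
  shows "ICK \<turnstile> \<phi>"
proof -
  interpret finite_canonical ICK \<phi> by unfold_locales simp
  interpret canonical_model ICK \<phi> "\<lambda>a \<Gamma> \<Delta>. \<forall>\<psi>. Know a \<psi> \<in> \<Gamma> \<longrightarrow> \<psi> \<in> \<Delta>"
    by (rule canonical_model_K)
  show ?thesis
    by (rule completeness[OF assms(1) _ assms(2)])
      (simp add: epistemic_frames_def epistemic_frame_pullback)
qed

lemma completeness_ICKT:
  assumes "infinite (UNIV :: 'w set)"
    and "valid_over (reflexive_frames :: ('w, 'a::finite) frame set) \<phi>"
  shows "ICKT \<turnstile> \<phi>"
proof -
  interpret finite_canonical ICKT \<phi> by unfold_locales (simp add: ICKT_def)
  interpret canonical_model ICKT \<phi> "\<lambda>a \<Gamma> \<Delta>. \<forall>\<psi>. Know a \<psi> \<in> \<Gamma> \<longrightarrow> \<psi> \<in> \<Delta>"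
    by (rule canonical_model_K)
  have "ax_T \<subseteq> ICKT" by (simp add: ICKT_def)
  then have "refl_on (worlds canonical_frame) (acc canonical_frame a)" for a
    by (auto simp: refl_on_def canonical_frame_def intro: prime_theory_Know)
  then show ?thesis
    by (intro completeness[OF assms(1) _ assms(2)])
      (simp add: reflexive_frames_def epistemic_frame_pullback refl_on_pullback)
qed

lemma completeness_ICKS4:
  assumes "infinite (UNIV :: 'w set)"
    and "valid_over (S4_frames :: ('w, 'a::finite) frame set) \<phi>"
  shows "ICKS4 \<turnstile> \<phi>"
proof -
  interpret finite_canonical ICKS4 \<phi> by unfold_locales (auto simp: ICKT_def ICKS4_def)
  interpret canonical_model ICKS4 \<phi> "\<lambda>a \<Gamma> \<Delta>. \<forall>\<psi>. Know a \<psi> \<in> \<Gamma> \<longrightarrow> Know a \<psi> \<in> \<Delta>"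
    by (rule canonical_model_S4) (auto simp: ICKT_def ICKS4_def)
  have "refl_on (worlds canonical_frame) (acc canonical_frame a)"
    and "trans (acc canonical_frame a)" for a
    by (auto simp: refl_on_def trans_def canonical_frame_def)
  then show ?thesis
    by (intro completeness[OF assms(1) _ assms(2)])
      (simp add: S4_frames_def epistemic_frame_pullback refl_on_pullback trans_pullback)
qed

lemma completeness_ICKS5:
  assumes "infinite (UNIV :: 'w set)"
    and "valid_over (S5_frames :: ('w, 'a::finite) frame set) \<phi>"
  shows "ICKS5 \<turnstile> \<phi>"
proof -
  interpret finite_canonical ICKS5 \<phi> by unfold_locales (auto simp: ICKT_def ICKS4_def ICKS5_def)
  interpret canonical_model ICKS5 \<phi> "\<lambda>a \<Gamma> \<Delta>. \<forall>\<psi>. Know a \<psi> \<in> \<Gamma> \<longleftrightarrow> Know a \<psi> \<in> \<Delta>"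
    by (rule canonical_model_S5) (auto simp: ICKT_def ICKS4_def ICKS5_def)
  have "refl_on (worlds canonical_frame) (acc canonical_frame a)"
    and "trans (acc canonical_frame a)" and "sym (acc canonical_frame a)" for a
    by (auto simp: refl_on_def trans_def sym_def canonical_frame_def)
  \<comment> \<open>The part of \<open>equiv\<close> that confines the relation to the
    worlds.\<close>
  moreover have "acc (pullback g D canonical_frame) a
      \<subseteq> worlds (pullback g D canonical_frame) \<times> worlds (pullback g D canonical_frame)"
    for g and D :: "'w set" and a
    by (auto simp: pullback_def)
  ultimately show ?thesis
    by (intro completeness[OF assms(1) _ assms(2)])
      (simp add: S5_frames_def equiv_def epistemic_frame_pullback refl_on_pullback
        trans_pullback sym_pullback)
qed

theorem mainTheorem8:
  fixes \<phi> :: "('a::finite, 'p) fm"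
  assumes "infinite (UNIV :: 'w set)"
  shows "(valid_over (epistemic_frames :: ('w, 'a) frame set) \<phi> \<longrightarrow> ICK \<turnstile> \<phi>) \<and>
         (valid_over (reflexive_frames :: ('w, 'a) frame set) \<phi> \<longrightarrow> ICKT \<turnstile> \<phi>) \<and>
         (valid_over (S4_frames :: ('w, 'a) frame set) \<phi> \<longrightarrow> ICKS4 \<turnstile> \<phi>) \<and>
         (valid_over (S5_frames :: ('w, 'a) frame set) \<phi> \<longrightarrow> ICKS5 \<turnstile> \<phi>)"
  using completeness_ICK completeness_ICKT completeness_ICKS4 completeness_ICKS5 assms by blast

end
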